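(* Let $d\ge 1$ and $m>n\ge 1$ be integers, and let $f(d,n,m)$ be the minimum number of sets in an antipodal $(n,m)$-fold cover of $S^d$ with open sets. Then \[\left\lceil \tfrac{d-1}{2}\right\rceil+n+m \le f(d,n,m)\le d+n+m.\]
   Context: $S^d$ denotes the $d$-dimensional unit sphere in $\mathbb{R}^{d+1}$ centered at the origin. A cover of $S^d$ is a (finite) family of subsets of $S^d$; it is an $n$-fold cover if every point of $S^d$ belongs to at least $n$ of the sets. A cover is antipodal if none of its sets contains a pair of antipodal points $x,-x$. The open northern hemisphere is $\{x\in S^d: x_{d+1}>0\}$. For $m>n\ge 1$, an $(n,m)$-fold cover of $S^d$ is an $n$-fold cover of $S^d$ in which every point of the open northern hemisphere belongs to at least $m$ of the sets. *)

theory Defs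
  imports "HOL-Analysis.Analysis"
begin

text \<open>We model R^(d+1) as the product type 'a \<times> real, where 'a is a Euclidean space of
dimension d = DIM('a) (so d \<ge> 1 automatically). The last coordinate x_(d+1) is snd x.
S^d is sphere 0 1 in this space.\<close>

definition antipodal_nm_cover ::
  "nat \<Rightarrow> nat \<Rightarrow> nat \<Rightarrow> (nat \<Rightarrow> ('a::euclidean_space \<times> real) set) \<Rightarrow> bool" where
  "antipodal_nm_cover n m k U \<longleftrightarrow>
     (\<forall>i<k. U i \<subseteq> sphere 0 1 \<and> openin (top_of_set (sphere 0 1)) (U i)
            \<and> (\<forall>x\<in>U i. - x \<notin> U i))
   \<and> (\<forall>x\<in>sphere 0 1. n \<le> card {i. i < k \<and> x \<in> U i})
   \<and> (\<forall>x\<in>sphere 0 1. 0 < snd x \<longrightarrow> m \<le> card {i. i < k \<and> x \<in> U i})"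

definition min_antipodal_cover :: "'a::euclidean_space itself \<Rightarrow> nat \<Rightarrow> nat \<Rightarrow> nat" where
  "min_antipodal_cover _ n m =
     (LEAST k. \<exists>U :: nat \<Rightarrow> ('a \<times> real) set. antipodal_nm_cover n m k U)"

end

theory Submission
  imports
    Defs
    "HOL-Homology.Invariance_of_Domain"
    "HOL-Computational_Algebra.Polynomial"
begin

text \<open>
  Upper bound: identify a point \<open>x\<close> of the sphere with the nonzero polynomial \<open>p\<^sub>x\<close> of degree at most \<open>d\<close>
  whose coefficients are the coordinates of \<open>x\<close>. The \<open>d + 2n\<close> open hemispheres
  \<open>(-1)\<^sup>i p\<^sub>x(i) > 0\<close> cover the sphere \<open>n\<close> times (Gale), and \<open>m - n\<close> copies of the open northern
  hemisphere do the rest.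

  Lower bound: the sets induce an antipodal \<open>n\<close>-fold cover of the equator, and some equatorial point lies
  in at least \<open>\<lfloor>d/2\<rfloor> + n\<close> of them. Moving it slightly south keeps it in these sets, and its antipode is a
  northern point lying in \<open>m\<close> further sets. For \<open>n = 1\<close> the multiplicity claim follows from the
  Borsuk-Ulam theorem: if \<open>h\<close> is a partition of unity subordinate to the cover, the moments
  \<open>\<Sum>\<^sub>i (h\<^sub>i(x) - h\<^sub>i(-x)) i\<^sup>j\<close> for \<open>1 \<le> j < d\<close> are odd functions of \<open>x\<close>, so they have a common zero;
  were all multiplicities at most \<open>\<lfloor>d/2\<rfloor>\<close>, the difference vector would have at most \<open>d\<close> nonzero entries
  and, by Vandermonde, would vanish, which is impossible for an antipodal cover.

  Borsuk-Ulam: a nowhere vanishing odd map from the \<open>n\<close>-sphere to \<open>n\<close>-space is approximated by a polynomial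
  one and put in general position so that it can be deformed to respect the flag of coordinate subspheres.
  The mod 2 degree is then the same on all of them, but it is 0 at the top and 1 on the 0-sphere.
\<close>

subsection \<open>Alternating sums and moments\<close>

lemma degree_diff_shift_less:
  fixes p :: "'a::idom poly"
  assumes "degree p > 0"
  shows "degree (p - pcompose p [:1, 1:]) < degree p"
proof -
  have deg: "degree (pcompose p [:1, 1:]) = degree p"
    by (simp add: degree_pcompose)
  moreover have "poly.coeff (pcompose p [:1, 1:]) (degree p) = lead_coeff p"
    using lead_coeff_comp[of "[:1, 1::'a:]" p] deg by simp
  ultimately have "degree (p - pcompose p [:1, 1:]) < degree p" if "p - pcompose p [:1, 1:] \<noteq> 0"
    using that by (intro degree_less_if_less_eqI degree_diff_le) auto
  then show ?thesis
    using assms by (metis degree_0)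
qed

text \<open>By Pascal's rule the sum for \<open>Suc N\<close> and \<open>p\<close> is the sum for
  \<open>N\<close> and \<open>p(X) - p(X + 1)\<close>, whose degree is smaller.\<close>

lemma alternating_binomial_sum_poly_eq_0:
  fixes p :: "real poly"
  assumes "degree p < N"
  shows "(\<Sum>i\<le>N. (-1) ^ i * real (N choose i) * poly p (real i)) = 0"
  using assms
proof (induction N arbitrary: p)
  case 0
  then show ?case by simp
next
  case (Suc N)
  let ?T = "\<lambda>N (p :: real poly) i. (-1) ^ i * real (N choose i) * poly p (real i)"
  let ?q = "p - pcompose p [:1, 1:]"
  have "(\<Sum>i\<le>Suc N. ?T (Suc N) p i) = poly p 0 + (\<Sum>i\<le>N. ?T (Suc N) p (Suc i))"
    by (subst sum.atMost_Suc_shift) simp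
  also have "(\<Sum>i\<le>N. ?T (Suc N) p (Suc i)) =
      (\<Sum>i\<le>N. ?T N p (Suc i)) - (\<Sum>i\<le>N. ?T N (pcompose p [:1, 1:]) i)"
    unfolding sum_subtractf[symmetric]
    by (intro sum.cong refl) (simp add: poly_pcompose algebra_simps)
  also have "(\<Sum>i\<le>N. ?T N p (Suc i)) = (\<Sum>i\<le>Suc N. ?T N p i) - poly p 0"
    by (subst sum.atMost_Suc_shift) simp
  also have "(\<Sum>i\<le>Suc N. ?T N p i) = (\<Sum>i\<le>N. ?T N p i)"
    by simp
  finally have eq: "(\<Sum>i\<le>Suc N. ?T (Suc N) p i) = (\<Sum>i\<le>N. ?T N ?q i)"
    by (simp add: sum_subtractf[symmetric] algebra_simps)
  show ?case
  proof (cases "degree p = 0")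
    case True
    then obtain a where "p = [:a:]" by (rule degree_eq_zeroE)
    then have "?q = 0" by simp
    then show ?thesis unfolding eq by simp
  next
    case False
    then have "degree ?q < N"
      using degree_diff_shift_less[of p] Suc.prems by simp
    then show ?thesis unfolding eq by (rule Suc.IH)
  qed
qed

text \<open>Vandermonde argument: a polynomial that vanishes on the rest of the support of
  \<open>v\<close> but not at \<open>i\<close> can be chosen of degree below \<open>K\<close>. Its
  sum against \<open>v\<close> is a combination of zero moments, yet equals \<open>v i\<close> times
  a nonzero value.\<close>

lemma vanishing_moments_imp_zero:
  fixes v :: "nat \<Rightarrow> real"
  assumes "finite I"
    and card: "card {i \<in> I. v i \<noteq> 0} \<le> K"
    and moments: "\<And>j. j < K \<Longrightarrow> (\<Sum>i\<in>I. v i * real i ^ j) = 0"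
    and "i \<in> I"
  shows "v i = 0"
proof (rule ccontr)
  assume "v i \<noteq> 0"
  let ?A = "{i \<in> I. v i \<noteq> 0} - {i}"
  define P :: "real poly" where "P = (\<Prod>l\<in>?A. [:- real l, 1:])"
  have "card ?A < card {i \<in> I. v i \<noteq> 0}"
    using \<open>finite I\<close> \<open>i \<in> I\<close> \<open>v i \<noteq> 0\<close> by (intro card_Diff1_less) auto
  then have "card ?A < K" using card by simp
  moreover have "degree P = card ?A"
    unfolding P_def by (subst degree_prod_eq_sum_degree) auto
  ultimately have "degree P < K" by simp
  have "(\<Sum>l\<in>I. v l * poly P (real l)) = (\<Sum>l\<in>I. \<Sum>j\<le>degree P. poly.coeff P j * (v l * real l ^ j))"
    by (simp add: poly_altdef sum_distrib_left algebra_simps)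
  also have "\<dots> = (\<Sum>j\<le>degree P. poly.coeff P j * (\<Sum>l\<in>I. v l * real l ^ j))"
    by (subst sum.swap) (simp add: sum_distrib_left)
  also have "\<dots> = 0"
    using \<open>degree P < K\<close> moments by (intro sum.neutral) auto
  finally have "(\<Sum>l\<in>I. v l * poly P (real l)) = 0" .
  moreover have "v l * poly P (real l) = 0" if "l \<in> I - {i}" for l
    using that \<open>finite I\<close> by (auto simp: P_def poly_prod)
  ultimately have "v i * poly P (real i) = 0"
    using \<open>finite I\<close> \<open>i \<in> I\<close> by (simp add: sum.remove[of I i])
  moreover have "poly P (real i) \<noteq> 0"
    using \<open>finite I\<close> by (auto simp: P_def poly_prod)
  ultimately show False using \<open>v i \<noteq> 0\<close> by simp
qed

text \<open>Multiplying by the squares of the linear factors at the positive positions kills the positive terms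
  of the vanishing alternating sum and leaves all signs unchanged, so every other term is zero.\<close>
lemma card_alternating_positive_ge:
  fixes p :: "real poly"
  assumes "p \<noteq> 0" "degree p \<le> d" "1 \<le> n"
  shows "n \<le> card {i. i < d + 2 * n \<and> 0 < (-1) ^ i * poly p (real i)}"
proof (rule ccontr)
  define J where "J = {i. i < d + 2 * n \<and> 0 < (-1) ^ i * poly p (real i)}"
  assume "\<not> ?thesis"
  then have cardJ: "card J < n" by (simp add: J_def)
  have finJ: "finite J" by (simp add: J_def)
  define q :: "real poly" where "q = (\<Prod>l\<in>J. [:- real l, 1:] ^ 2)"
  \<comment> \<open>\<open>N\<close> is the last index, and \<open>p * q\<close> has degree at most
    \<open>d + 2 * (n - 1)\<close>, which is \<open>N - 1\<close>.\<close>
  define N where "N = d + 2 * n - 1"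
  have "degree q = 2 * card J"
    unfolding q_def by (subst degree_prod_eq_sum_degree) (auto simp: degree_power_eq)
  then have "degree (p * q) < N"
    using degree_mult_le[of p q] assms cardJ by (simp add: N_def)
  then have sum0: "(\<Sum>i\<le>N. (-1) ^ i * real (N choose i) * poly (p * q) (real i)) = 0"
    by (rule alternating_binomial_sum_poly_eq_0)
  have q_ge: "0 \<le> poly q x" for x
    by (simp add: q_def poly_prod prod_nonneg)
  have q_pos: "poly q (real i) = 0 \<longleftrightarrow> i \<in> J" for i
    using finJ by (auto simp: q_def poly_prod)
  have nonpos: "(-1) ^ i * real (N choose i) * poly (p * q) (real i) \<le> 0" if "i \<le> N" for i
  proof (cases "i \<in> J")
    case True
    then have "poly q (real i) = 0" by (simp only: q_pos)
    then show ?thesis by simp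
  next
    case False
    then have "(-1) ^ i * poly p (real i) \<le> 0"
      using that assms by (auto simp: J_def N_def)
    then have "((-1) ^ i * poly p (real i)) * (real (N choose i) * poly q (real i)) \<le> 0"
      by (rule mult_nonpos_nonneg) (simp add: q_ge)
    then show ?thesis by (simp add: algebra_simps)
  qed
  have "\<forall>i\<in>{..N}. - ((-1) ^ i * real (N choose i) * poly (p * q) (real i)) = 0"
    using sum0 nonpos by (subst sum_nonneg_eq_0_iff[symmetric]) (auto simp: sum_negf)
  then have zero: "poly p (real i) = 0" if "i \<in> {..N} - J" for i
    using that q_pos[of i] by auto
  \<comment> \<open>At least \<open>d + n + 1\<close> indices lie outside \<open>J\<close>, too many
    roots for degree at most \<open>d\<close>.\<close>
  have "card {..N} - card J \<le> card ({..N} - J)"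
    using finJ by (intro diff_card_le_card_Diff)
  also have "\<dots> = card (real ` ({..N} - J))"
    by (simp add: card_image)
  also have "\<dots> \<le> card {x. poly p x = 0}"
    using zero poly_roots_finite[OF \<open>p \<noteq> 0\<close>] by (intro card_mono) auto
  also have "\<dots> \<le> degree p"
    using \<open>p \<noteq> 0\<close> by (rule card_poly_roots_bound)
  finally show False
    using assms cardJ by (simp add: N_def)
qed

subsection \<open>The Borsuk-Ulam theorem\<close>

locale basis_enumeration =
  fixes b :: "nat \<Rightarrow> 'a::euclidean_space"
  assumes bij_basis: "bij_betw b {..<DIM('a)} Basis"
begin

text \<open>The unit sphere of the span of the first \<open>k\<close> basis vectors, of dimension
  \<open>k - 1\<close>; it is empty for \<open>k = 0\<close>.\<close>

definition coord_sphere :: "nat \<Rightarrow> 'a set" where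
  "coord_sphere k = {x. norm x = 1 \<and> (\<forall>i. k \<le> i \<longrightarrow> i < DIM('a) \<longrightarrow> x \<bullet> b i = 0)}"

lemma inner_basis:
  assumes "i < DIM('a)" "j < DIM('a)"
  shows "b i \<bullet> b j = (if i = j then 1 else 0)"
proof -
  have "b i \<in> Basis" "b j \<in> Basis" "b i = b j \<longleftrightarrow> i = j"
    using bij_basis assms by (auto simp: bij_betw_def inj_on_def)
  then show ?thesis by (auto simp: inner_Basis)
qed

lemma inner_sum_basis [simp]:
  assumes "j < DIM('a)"
  shows "(\<Sum>i<DIM('a). f i *\<^sub>R b i) \<bullet> b j = f j"
proof -
  have "(\<Sum>i<DIM('a). f i *\<^sub>R b i) \<bullet> b j = (\<Sum>i<DIM('a). if i = j then f i else 0)"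
    unfolding inner_sum_left by (rule sum.cong) (use assms in \<open>auto simp: inner_basis\<close>)
  then show ?thesis using assms by simp
qed

lemma eq_coordI:
  assumes "\<And>i. i < DIM('a) \<Longrightarrow> x \<bullet> b i = y \<bullet> b i"
  shows "x = y"
proof (rule euclidean_eqI)
  fix u :: 'a assume "u \<in> Basis"
  then obtain i where "i < DIM('a)" "u = b i"
    using bij_basis by (auto simp: bij_betw_def)
  then show "x \<bullet> u = y \<bullet> u" using assms by simp
qed

lemma norm_power2_coord: "(norm x)\<^sup>2 = (\<Sum>i<DIM('a). (x \<bullet> b i)\<^sup>2)"
proof -
  have "(norm x)\<^sup>2 = (\<Sum>u\<in>Basis. (x \<bullet> u)\<^sup>2)"
    by (subst power2_norm_eq_inner, subst euclidean_inner) (simp add: power2_eq_square)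
  then show ?thesis
    using sum.reindex_bij_betw[OF bij_basis, of "\<lambda>u. (x \<bullet> u)\<^sup>2"] by simp
qed

text \<open>Padding with the unused coordinates makes the set of bad coefficients the differentiable image
  of a cylinder over a sphere, hence a null set.\<close>
lemma generic_coefficients:
  fixes f :: "nat \<Rightarrow> 'a \<Rightarrow> real"
  assumes "k < DIM('a)"
    and diff: "\<And>i x. i \<le> k \<Longrightarrow> f i differentiable (at x)"
    and nz: "\<And>x. x \<in> coord_sphere (Suc k) \<Longrightarrow> \<exists>i\<le>k. f i x \<noteq> 0"
  obtains c where "\<And>x. x \<in> coord_sphere k \<Longrightarrow> \<exists>i<k. f i x + c i * f k x \<noteq> 0"
proof -
  define P :: "'a \<Rightarrow> 'a" where
    "P y = (\<Sum>i<DIM('a). (if i < k then y \<bullet> b i else 0) *\<^sub>R b i)" for y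
  \<comment> \<open>The first \<open>k\<close> coordinates of \<open>g y\<close> are the
    coefficients for which all combinations vanish at \<open>P y\<close>; the others are copied from
    \<open>y\<close>.\<close>
  define g :: "'a \<Rightarrow> 'a" where
    "g y = (\<Sum>i<DIM('a). (if i < k then - f i (P y) / f k (P y) else y \<bullet> b i) *\<^sub>R b i)" for y
  define C where "C = {y. norm (P y) = 1 \<and> f k (P y) \<noteq> 0}"
  have P_diff: "P differentiable (at y)" for y
    unfolding P_def
  proof (intro differentiable_sum differentiable_scaleR ballI finite_lessThan differentiable_const)
    fix i
    show "(\<lambda>y. if i < k then y \<bullet> b i else 0) differentiable (at y)"
      by (cases "i < k") (auto intro!: bounded_linear_imp_differentiable bounded_linear_inner_left)
  qed
  have P_scale: "P (c *\<^sub>R y) = c *\<^sub>R P y" for c y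
    by (rule eq_coordI) (simp add: P_def)
  have "continuous_on UNIV P"
    by (simp add: differentiable_imp_continuous_on differentiable_on_def P_diff)
  then have "closed {y. norm (P y) = 1}"
    by (intro closed_Collect_eq continuous_intros)
  \<comment> \<open>Each ray from the origin meets the cylinder at most once.\<close>
  then have "negligible {y. norm (P y) = 1}"
    by (rule starlike_negligible[where a = 0]) (simp add: P_scale)
  then have "negligible C"
    by (rule negligible_subset) (auto simp: C_def)
  moreover have "g differentiable_on C"
  proof -
    have fP: "(\<lambda>y. f i (P y)) differentiable (at y)" if "i \<le> k" for i y
      using differentiable_chain_at[OF P_diff diff[OF that]] by (simp add: o_def)
    have "g differentiable (at y)" if "y \<in> C" for y
      unfolding g_def
    proof (intro differentiable_sum differentiable_scaleR ballI finite_lessThan differentiable_const)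
      fix i
      show "(\<lambda>y. if i < k then - f i (P y) / f k (P y) else y \<bullet> b i) differentiable (at y)"
      proof (cases "i < k")
        case True
        then show ?thesis
          using that by (simp add: C_def fP)
      next
        case False
        then show ?thesis
          by (simp add: bounded_linear_imp_differentiable bounded_linear_inner_left)
      qed
    qed
    then show ?thesis
      by (auto simp: differentiable_on_def intro: differentiable_at_withinI)
  qed
  ultimately have "negligible (g ` C)"
    by (intro negligible_differentiable_image_negligible) auto
  then have "g ` C \<noteq> UNIV" by auto
  then obtain z where z: "z \<notin> g ` C" by blast
  show thesis
  proof (rule that[of "\<lambda>i. z \<bullet> b i"], rule ccontr)
    fix x assume x: "x \<in> coord_sphere k"
    assume "\<not> (\<exists>i<k. f i x + (z \<bullet> b i) * f k x \<noteq> 0)"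
    then have zero: "f i x + (z \<bullet> b i) * f k x = 0" if "i < k" for i
      using that by blast
    have "x \<in> coord_sphere (Suc k)"
      using x by (auto simp: coord_sphere_def)
    then have fk: "f k x \<noteq> 0"
      using nz zero by (metis add_cancel_right_right le_neq_implies_less mult_zero_right)
    \<comment> \<open>Padding \<open>x\<close> with the remaining coordinates of \<open>z\<close>
      makes \<open>g y = z\<close> when every combination vanishes at \<open>x\<close>.\<close>
    define y where "y = (\<Sum>i<DIM('a). (if i < k then x \<bullet> b i else z \<bullet> b i) *\<^sub>R b i)"
    have Py: "P y = x"
      using x by (intro eq_coordI) (auto simp: P_def y_def coord_sphere_def)
    have "- f i x / f k x = z \<bullet> b i" if "i < k" for i
      using zero[OF that] fk by (simp add: field_simps add_eq_0_iff)
    then have "g y \<bullet> b i = z \<bullet> b i" if "i < DIM('a)" for i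
      using that by (simp add: g_def Py) (simp add: y_def)
    then have "g y = z" by (rule eq_coordI)
    moreover have "y \<in> C"
      using x fk by (auto simp: C_def Py coord_sphere_def)
    ultimately show False using z by blast
  qed
qed

text \<open>Generic multiples of the last function, added to the others, free the next smaller
  subsphere of their common zeros; the last function itself is kept. The change is triangular, so
  common zeros of \<open>g\<close> are common zeros of \<open>f\<close>, and nonvanishing outside
  the flag members treated here survives.\<close>

lemma triangular_general_position:
  fixes f :: "nat \<Rightarrow> 'a \<Rightarrow> real"
  assumes "k \<le> DIM('a)"
    and "\<And>i x. i < k \<Longrightarrow> f i differentiable (at x)"
    and "\<And>i x. i < k \<Longrightarrow> f i (- x) = - f i x"
    and "\<And>x. x \<in> coord_sphere k \<Longrightarrow> \<exists>i<k. f i x \<noteq> 0"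
  shows "\<exists>g :: nat \<Rightarrow> 'a \<Rightarrow> real. (\<forall>i<k. \<forall>x. g i differentiable (at x) \<and> g i (- x) = - g i x)
    \<and> (\<forall>x. (\<forall>i<k. g i x = 0) \<longrightarrow> (\<forall>i<k. f i x = 0))
    \<and> (\<forall>j\<le>k. \<forall>x\<in>coord_sphere j. \<exists>i<j. g i x \<noteq> 0)"
  using assms
proof (induction k arbitrary: f)
  case 0
  then show ?case by auto
next
  case (Suc k)
  obtain c where c: "\<And>x. x \<in> coord_sphere k \<Longrightarrow> \<exists>i<k. f i x + c i * f k x \<noteq> 0"
    using generic_coefficients[of k f] Suc.prems by (metis Suc_le_lessD less_Suc_eq_le)
  let ?h = "\<lambda>i x. f i x + c i * f k x"
  have "\<exists>g :: nat \<Rightarrow> 'a \<Rightarrow> real. (\<forall>i<k. \<forall>x. g i differentiable (at x) \<and> g i (- x) = - g i x)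
    \<and> (\<forall>x. (\<forall>i<k. g i x = 0) \<longrightarrow> (\<forall>i<k. ?h i x = 0))
    \<and> (\<forall>j\<le>k. \<forall>x\<in>coord_sphere j. \<exists>i<j. g i x \<noteq> 0)"
  proof (rule Suc.IH[of ?h])
    show "?h i differentiable (at x)" if "i < k" for i x
      using that Suc.prems(2) by (intro differentiable_add differentiable_mult differentiable_const) auto
    show "?h i (- x) = - ?h i x" if "i < k" for i x
      using that Suc.prems(3)[of i x] Suc.prems(3)[of k x] by simp
  qed (use Suc.prems(1) c in auto)
  then obtain g :: "nat \<Rightarrow> 'a \<Rightarrow> real"
    where g: "\<forall>i<k. \<forall>x. g i differentiable (at x) \<and> g i (- x) = - g i x"
    "\<forall>x. (\<forall>i<k. g i x = 0) \<longrightarrow> (\<forall>i<k. ?h i x = 0)"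
    "\<forall>j\<le>k. \<forall>x\<in>coord_sphere j. \<exists>i<j. g i x \<noteq> 0"
    by (elim exE conjE)
  let ?g = "g(k := f k)"
  have zero: "\<forall>i<Suc k. f i x = 0" if "\<forall>i<Suc k. ?g i x = 0" for x
  proof -
    have "f k x = 0" using that by auto
    moreover have "g i x = 0" if "i < k" for i
      using \<open>\<forall>i<Suc k. ?g i x = 0\<close>[rule_format, of i] that by simp
    ultimately show ?thesis using g(2)[rule_format, of x] by (auto simp: less_Suc_eq)
  qed
  have "\<exists>i<j. ?g i x \<noteq> 0" if "j \<le> Suc k" "x \<in> coord_sphere j" for j x
  proof (cases "j = Suc k")
    case True
    then show ?thesis using zero[of x] Suc.prems(4) that by metis
  next
    case False
    then have "\<exists>i<j. g i x \<noteq> 0" using that g(3)[rule_format, of j x] by auto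
    then obtain i where "i < j" "g i x \<noteq> 0" by blast
    then show ?thesis using that False by (intro exI[of _ i]) auto
  qed
  then show ?case
    using zero g(1) Suc.prems by (intro exI[of _ ?g]) (auto simp: less_Suc_eq)
qed


text \<open>The weights in \<open>G\<close> make the map send each coordinate subsphere to itself, so that
  the parity of the degree can be compared along the whole flag, down to the 0-sphere.\<close>
lemma no_nested_odd_map:
  fixes f :: "nat \<Rightarrow> 'a \<Rightarrow> real"
  assumes dim: "DIM('a) = Suc n"
    and cont: "\<And>i. i < n \<Longrightarrow> continuous_on UNIV (f i)"
    and odd: "\<And>i x. i < n \<Longrightarrow> f i (- x) = - f i x"
    and nz: "\<And>x. norm x = 1 \<Longrightarrow> \<exists>i<n. f i x \<noteq> 0"
    and nested: "\<And>j x. j \<le> n \<Longrightarrow> x \<in> coord_sphere j \<Longrightarrow> \<exists>i<j. f i x \<noteq> 0"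
  shows False
proof -
  define E :: "(nat \<Rightarrow> real) \<Rightarrow> 'a" where "E x = (\<Sum>i<DIM('a). x i *\<^sub>R b i)" for x
  \<comment> \<open>On \<open>nsphere j\<close> the weight vanishes for \<open>i > j\<close>; it is
    positive for \<open>i\<close> up to the last nonzero coordinate of \<open>x\<close>.\<close>
  define G where "G x i = (\<Sum>l=i..n. (x l)\<^sup>2) * f i (E x)" for x :: "nat \<Rightarrow> real" and i
  define N where "N x = sqrt (\<Sum>i<n. (G x i)\<^sup>2)" for x
  \<comment> \<open>Coordinate \<open>n\<close> is 0, so on the top sphere \<open>g\<close> maps
    into the equator and misses the poles.\<close>
  define g where "g x i = (if i < n then G x i / N x else 0)" for x i
  have top: "x \<in> topspace (nsphere j) \<longleftrightarrow> (\<Sum>i\<le>j. (x i)\<^sup>2) = 1 \<and> (\<forall>i>j. x i = 0)" for x j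
    by (simp add: nsphere)
  have top_mono: "x \<in> topspace (nsphere n)" if "x \<in> topspace (nsphere j)" "j \<le> n" for x j
  proof -
    have "(\<Sum>i\<le>j. (x i)\<^sup>2) = (\<Sum>i\<le>n. (x i)\<^sup>2)"
      using that by (intro sum.mono_neutral_left) (auto simp: top)
    then show ?thesis using that by (auto simp: top)
  qed
  have E_norm: "norm (E x) = 1" if "x \<in> topspace (nsphere n)" for x
  proof -
    have "(norm (E x))\<^sup>2 = (\<Sum>i<DIM('a). (x i)\<^sup>2)"
      unfolding norm_power2_coord E_def by (intro sum.cong refl) simp
    also have "\<dots> = 1" using that by (simp add: dim top lessThan_Suc_atMost)
    finally show ?thesis by (simp add: norm_eq_1 power2_norm_eq_inner)
  qed
  \<comment> \<open>Index shift: \<open>nsphere j\<close> has dimension \<open>j\<close> and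
    therefore \<open>j + 1\<close> coordinates.\<close>
  have E_sphere: "E x \<in> coord_sphere (Suc j)" if "x \<in> topspace (nsphere j)" "j \<le> n" for x j
    using that E_norm[OF top_mono[OF that]] by (auto simp: coord_sphere_def E_def top)
  have E_neg: "E (\<lambda>i. - x i) = - E x" for x
    by (simp add: E_def sum_negf)
  have E_cont: "continuous_on UNIV E"
    unfolding E_def by (intro continuous_intros) simp
  have N_pos: "N x > 0" if x: "x \<in> topspace (nsphere n)" for x
  proof -
    have "\<exists>i<n. G x i \<noteq> 0"
    proof -
      have "\<exists>i\<le>n. x i \<noteq> 0"
        using x by (auto simp: top intro: ccontr)
      then have ne: "{i. i \<le> n \<and> x i \<noteq> 0} \<noteq> {}" by blast
      \<comment> \<open>The last nonzero coordinate places \<open>x\<close> in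
        \<open>nsphere j\<close>. A nonzero \<open>f i (E x)\<close> with \<open>i \<le> j\<close>
        then comes from \<open>nz\<close> if \<open>j = n\<close> and from \<open>nested\<close>
        otherwise.\<close>
      define j where "j = Max {i. i \<le> n \<and> x i \<noteq> 0}"
      have "j \<in> {i. i \<le> n \<and> x i \<noteq> 0}"
        unfolding j_def using ne by (intro Max_in) auto
      then have j: "j \<le> n" "x j \<noteq> 0" by auto
      have j_max: "x i = 0" if "j < i" "i \<le> n" for i
      proof (rule ccontr)
        assume "x i \<noteq> 0"
        then have "i \<le> j" unfolding j_def using that by (intro Max_ge) auto
        then show False using that by simp
      qed
      have pos: "(\<Sum>l=i..n. (x l)\<^sup>2) \<noteq> 0" if "i \<le> j" for i
        using that j by (subst sum_nonneg_eq_0_iff) auto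
      have "\<exists>i<n. i \<le> j \<and> f i (E x) \<noteq> 0"
      proof (cases "j = n")
        case True
        then show ?thesis using nz[OF E_norm[OF x]] by (auto intro: less_imp_le)
      next
        case False
        have "(\<Sum>i\<le>j. (x i)\<^sup>2) = (\<Sum>i\<le>n. (x i)\<^sup>2)"
          using j j_max by (intro sum.mono_neutral_left) auto
        moreover have "x i = 0" if "i > j" for i
          using that j_max x by (cases "i \<le> n") (auto simp: top)
        ultimately have "x \<in> topspace (nsphere j)" using x by (auto simp: top)
        then have "\<exists>i<Suc j. f i (E x) \<noteq> 0"
          using False j by (intro nested E_sphere) auto
        then obtain i where "i \<le> j" "f i (E x) \<noteq> 0" by (auto simp: less_Suc_eq_le)
        then show ?thesis using False j by (intro exI[of _ i]) auto
      qed
      then show ?thesis using pos by (auto simp: G_def)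
    qed
    then have "(\<Sum>i<n. (G x i)\<^sup>2) \<noteq> 0"
      by (subst sum_nonneg_eq_0_iff) auto
    then show ?thesis
      by (simp add: N_def sum_nonneg less_le)
  qed
  have g_norm: "(\<Sum>i\<le>n. (g x i)\<^sup>2) = 1" if "x \<in> topspace (nsphere n)" for x
  proof -
    have "(\<Sum>i\<le>n. (g x i)\<^sup>2) = (\<Sum>i<n. (G x i)\<^sup>2 / (N x)\<^sup>2)"
      unfolding lessThan_Suc_atMost[symmetric] sum.lessThan_Suc
      by (auto simp: g_def power_divide intro!: sum.cong)
    also have "\<dots> = (N x)\<^sup>2 / (N x)\<^sup>2"
      by (simp add: sum_divide_distrib[symmetric] N_def sum_nonneg)
    finally show ?thesis using N_pos[OF that] by simp
  qed
  have g_maps: "g x \<in> topspace (nsphere j)" if "x \<in> topspace (nsphere j)" "j \<le> n" for x j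
  proof -
    have zero: "g x i = 0" if "i > j" for i
    proof -
      have "(\<Sum>l=i..n. (x l)\<^sup>2) = 0"
        using that \<open>x \<in> topspace (nsphere j)\<close> by (intro sum.neutral) (auto simp: top)
      then show ?thesis by (simp add: g_def G_def)
    qed
    have "(\<Sum>i\<le>j. (g x i)\<^sup>2) = (\<Sum>i\<le>n. (g x i)\<^sup>2)"
      using zero \<open>j \<le> n\<close> by (intro sum.mono_neutral_left) auto
    then show ?thesis
      using zero g_norm[OF top_mono[OF that]] by (simp add: top)
  qed
  have nsphere_eq: "nsphere j = top_of_set (topspace (nsphere j))" for j
    unfolding nsphere by (simp add: euclidean_product_topology)
  have g_cont: "continuous_map (nsphere j) (nsphere j) g" if "j \<le> n" for j
  proof -
    let ?S = "topspace (nsphere j)"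
    have G_cont: "continuous_on ?S (\<lambda>x. G x i)" if "i < n" for i
      unfolding G_def
      by (intro continuous_intros continuous_on_compose2[OF cont[OF that]]
          continuous_on_subset[OF E_cont] continuous_on_subset[OF continuous_on_product_coordinates]) auto
    have "continuous_on ?S g"
      unfolding g_def
    proof (intro continuous_on_coordinatewise_then_product)
      fix i
      show "continuous_on ?S (\<lambda>x. if i < n then G x i / N x else 0)"
        using N_pos[OF top_mono[OF _ that]]
        by (cases "i < n") (auto simp: N_def intro!: continuous_intros G_cont, force)
    qed
    then have "continuous_map (top_of_set ?S) (top_of_set ?S) g"
      using g_maps[OF _ that] by auto
    then show ?thesis
      by (simp only: nsphere_eq[symmetric])
  qed
  have g_odd: "g (\<lambda>i. - x i) = (\<lambda>i. - g x i)" for x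
    by (auto simp: g_def G_def N_def E_neg odd fun_eq_iff)
  \<comment> \<open>Borsuk's step: an odd map preserving the equator has the same degree mod 2 as
    its restriction there.\<close>
  have "even (Brouwer_degree2 (n - k) g)" if "k \<le> n" for k
    using that
  proof (induction k)
    case 0
    have "(\<lambda>i. if i = n then 1 else 0) \<in> topspace (nsphere n)"
      by (simp add: top if_distrib[of "\<lambda>x. x ^ 2"] cong: if_cong)
    moreover have "(\<lambda>i. if i = n then 1 else 0) \<notin> range g"
      by (auto simp: g_def fun_eq_iff dest!: spec[of _ n])
    ultimately have "g ` topspace (nsphere n) \<noteq> topspace (nsphere n)"
      by blast
    then show ?case
      using Brouwer_degree2_nonsurjective[OF g_cont] by simp
  next
    case (Suc k)
    have "even (Brouwer_degree2 (n - k) g - Brouwer_degree2 (n - k - Suc 0) g)"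
      by (rule Borsuk_odd_mapping_degree_step) (use g_maps in \<open>auto simp: g_cont g_odd\<close>)
    then show ?case using Suc by simp
  qed
  from this[of n] have "even (Brouwer_degree2 0 g)" by simp
  \<comment> \<open>An odd self-map of the two-point sphere is the identity or the swap, hence an
    involution.\<close>
  moreover have "Brouwer_degree2 0 g * Brouwer_degree2 0 g = 1"
  proof -
    have sq: "g (g x) = x" if x: "x \<in> topspace (nsphere 0)" for x
    proof -
      have eq: "y = x \<or> y = (\<lambda>i. - x i)" if "y \<in> topspace (nsphere 0)" for y
      proof -
        have "y 0 = x 0 \<or> y 0 = - x 0"
          using x that by (auto simp: top power2_eq_1_iff)
        moreover have "y i = x i" "y i = - x i" if "i > 0" for i
          using x \<open>y \<in> topspace (nsphere 0)\<close> that by (auto simp: top)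
        ultimately show ?thesis
          by (metis gr0I ext)
      qed
      show ?thesis using eq[OF g_maps[OF x]] g_odd[of x] by auto
    qed
    have "Brouwer_degree2 0 g * Brouwer_degree2 0 g = Brouwer_degree2 0 (g \<circ> g)"
      by (rule Brouwer_degree2_compose[symmetric]) (simp_all add: g_cont)
    also have "\<dots> = Brouwer_degree2 0 id"
      by (rule Brouwer_degree2_eq) (simp add: sq)
    finally show ?thesis by simp
  qed
  ultimately show False
    by (metis even_mult_iff odd_one)
qed

end

theorem Borsuk_Ulam_odd:
  fixes f :: "nat \<Rightarrow> 'a::euclidean_space \<Rightarrow> real"
  assumes cont: "\<And>i. i < DIM('a) - 1 \<Longrightarrow> continuous_on (sphere 0 1) (f i)"
    and odd: "\<And>i x. i < DIM('a) - 1 \<Longrightarrow> x \<in> sphere 0 1 \<Longrightarrow> f i (- x) = - f i x"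
  shows "\<exists>x\<in>sphere 0 1. \<forall>i<DIM('a) - 1. f i x = 0"
proof (rule ccontr)
  assume no_zero: "\<not> ?thesis"
  define n where "n = DIM('a) - 1"
  have dim: "DIM('a) = Suc n" by (simp add: n_def)
  obtain b :: "nat \<Rightarrow> 'a" where "bij_betw b {0..<DIM('a)} Basis"
    using ex_bij_betw_nat_finite[OF finite_Basis] by blast
  then have "bij_betw b {..<DIM('a)} Basis" by (simp only: atLeast0LessThan)
  then interpret basis_enumeration b by unfold_locales
  define s where "s x = (\<Sum>i<n. \<bar>f i x\<bar>)" for x
  have s_pos: "0 < s x" if "x \<in> sphere 0 1" for x
  proof -
    have "\<not> (\<forall>i<DIM('a) - 1. f i x = 0)" using no_zero that by blast
    then obtain i where "i < n" "f i x \<noteq> 0" unfolding n_def by blast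
    then show ?thesis unfolding s_def by (intro sum_pos2[of _ i]) auto
  qed
  have "continuous_on (sphere 0 1) s"
    unfolding s_def by (intro continuous_intros cont) (simp add: n_def)
  moreover have "sphere (0::'a) 1 \<noteq> {}"
    by simp
  ultimately obtain z where z: "z \<in> sphere 0 1" "\<And>x. x \<in> sphere 0 1 \<Longrightarrow> s z \<le> s x"
    using continuous_attains_inf[of "sphere 0 1" s] compact_sphere by blast
  \<comment> \<open>Errors of at most \<open>e\<close> in \<open>n\<close> components stay below the
    minimum \<open>s z\<close> of the l1 norm; \<open>Suc n\<close> makes this strict.\<close>
  define e where "e = s z / real (Suc n)"
  have "e > 0" using s_pos[OF z(1)] by (simp add: e_def)
  have "\<exists>p. real_polynomial_function p \<and> (\<forall>x\<in>sphere 0 1. \<bar>f i x - p x\<bar> < e)" if "i < n" for i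
    using Stone_Weierstrass_real_polynomial_function[OF compact_sphere cont \<open>e > 0\<close>, of i] that
    by (metis n_def)
  then obtain p where p: "\<And>i. i < n \<Longrightarrow> real_polynomial_function (p i)"
    "\<And>i x. i < n \<Longrightarrow> x \<in> sphere 0 1 \<Longrightarrow> \<bar>f i x - p i x\<bar> < e"
    by metis
  \<comment> \<open>The odd part of an approximation to an odd function approximates it equally
    well.\<close>
  define q where "q i x = (p i x - p i (- x)) / 2" for i x
  have q_diff: "q i differentiable (at x)" if "i < n" for i x
  proof -
    have "p i differentiable (at y)" for y
      using p(1)[OF that] by (simp add: differentiable_at_polynomial_function real_polynomial_function_eq)
    from this differentiable_chain_at[OF _ this, of uminus]
    show ?thesis unfolding q_def
      by (intro differentiable_divide differentiable_diff) (auto simp: o_def)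
  qed
  have q_odd: "q i (- x) = - q i x" for i x
    by (simp add: q_def field_simps)
  have q_nz: "\<exists>i<n. q i x \<noteq> 0" if "norm x = 1" for x
  proof (rule ccontr)
    assume "\<not> ?thesis"
    \<comment> \<open>This common value is within \<open>e\<close> of both \<open>f i x\<close> and
      \<open>- f i x\<close>, so \<open>f i x\<close> is small.\<close>
    then have zero: "p i x = p i (- x)" if "i < n" for i using that by (auto simp: q_def)
    have "\<bar>f i x\<bar> \<le> e" if "i < n" for i
      using p(2)[OF that, of x] p(2)[OF that, of "- x"] odd[of i x] zero[OF that] that \<open>norm x = 1\<close>
      by (simp add: n_def)
    then have "s x \<le> real n * e"
      unfolding s_def using sum_bounded_above[of "{..<n}" "\<lambda>i. \<bar>f i x\<bar>" e] by simp
    also have "\<dots> < s z"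
      using s_pos[OF z(1)] by (simp add: e_def field_simps)
    finally show False using z(2)[of x] that by simp
  qed
  have "\<exists>g :: nat \<Rightarrow> 'a \<Rightarrow> real. (\<forall>i<n. \<forall>x. g i differentiable (at x) \<and> g i (- x) = - g i x)
    \<and> (\<forall>x. (\<forall>i<n. g i x = 0) \<longrightarrow> (\<forall>i<n. q i x = 0))
    \<and> (\<forall>j\<le>n. \<forall>x\<in>coord_sphere j. \<exists>i<j. g i x \<noteq> 0)"
    by (intro triangular_general_position q_diff q_odd q_nz) (auto simp: dim coord_sphere_def)
  then obtain g :: "nat \<Rightarrow> 'a \<Rightarrow> real"
    where g: "\<forall>i<n. \<forall>x. g i differentiable (at x) \<and> g i (- x) = - g i x"
    "\<forall>x. (\<forall>i<n. g i x = 0) \<longrightarrow> (\<forall>i<n. q i x = 0)"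
    "\<forall>j\<le>n. \<forall>x\<in>coord_sphere j. \<exists>i<j. g i x \<noteq> 0"
    by (elim exE conjE)
  show False
  proof (rule no_nested_odd_map[OF dim])
    show "continuous_on UNIV (g i)" if "i < n" for i
      using g(1) that by (simp add: differentiable_imp_continuous_on differentiable_on_def)
    show "\<exists>i<n. g i x \<noteq> 0" if "norm x = 1" for x
      using q_nz[OF that] g(2) by blast
  qed (use g in auto)
qed

subsection \<open>Antipodal covers\<close>

text \<open>A bound of \<open>DIM('a) div 2\<close> at both \<open>x\<close> and \<open>- x\<close>
  allows at most \<open>DIM('a)\<close> nonzero differences, matching the number of vanishing
  moments.\<close>

lemma antipodal_cover_multiplicity:
  fixes U :: "nat \<Rightarrow> 'a::euclidean_space set"
  assumes opn: "\<And>i. i < k \<Longrightarrow> openin (top_of_set (sphere 0 1)) (U i)"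
    and anti: "\<And>i x. i < k \<Longrightarrow> x \<in> U i \<Longrightarrow> - x \<notin> U i"
    and cover: "\<And>x. x \<in> sphere 0 1 \<Longrightarrow> \<exists>i<k. x \<in> U i"
  shows "\<exists>x\<in>sphere 0 1. DIM('a) div 2 + 1 \<le> card {i. i < k \<and> x \<in> U i}"
proof (rule ccontr)
  let ?S = "sphere (0::'a) 1"
  assume contra: "\<not> ?thesis"
  have few: "card {i. i < k \<and> x \<in> U i} \<le> DIM('a) div 2" if "x \<in> ?S" for x
  proof -
    have "\<not> DIM('a) div 2 + 1 \<le> card {i. i < k \<and> x \<in> U i}"
      using contra that by blast
    then show ?thesis by linarith
  qed
  \<comment> \<open>The distance to the complement is positive exactly on \<open>U i\<close>.
    Antipodality makes the complement nonempty, which matters because \<open>setdist\<close> to the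
    empty set is 0.\<close>
  define u where "u i x = setdist {x} (?S - U i)" for i x
  define s where "s x = (\<Sum>i<k. u i x)" for x
  define v where "v x i = u i x / s x - u i (- x) / s (- x)" for x i
  have u_pos: "0 < u i x \<longleftrightarrow> x \<in> U i" if "i < k" "x \<in> ?S" for i x
  proof -
    have "closedin (top_of_set ?S) (?S - U i)"
      using opn[OF that(1)] by (simp add: closedin_diff)
    then have "closed (?S - U i)"
      using closed_sphere by (blast intro: closedin_closed_trans)
    moreover have "- x \<in> ?S" using that(2) by simp
    then have "?S - U i \<noteq> {}" using that anti[OF that(1), of x] by blast
    ultimately have "u i x = 0 \<longleftrightarrow> x \<in> ?S - U i"
      unfolding u_def by (subst setdist_eq_0_closed) auto
    then show ?thesis
      using that by (auto simp: u_def less_le)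
  qed
  have u_ge: "0 \<le> u i x" for i x by (simp add: u_def)
  have s_pos: "0 < s x" if "x \<in> ?S" for x
  proof -
    obtain i where "i < k" "x \<in> U i" using cover \<open>x \<in> ?S\<close> by blast
    then show ?thesis
      unfolding s_def using that by (intro sum_pos2[of _ i] u_ge) (auto simp: u_pos)
  qed
  have u_cont: "continuous_on A (u i)" for A i
    unfolding u_def by (intro continuous_on_setdist)
  have s_cont: "continuous_on A s" for A
    unfolding s_def by (intro continuous_intros u_cont)
  have v_cont: "continuous_on ?S (\<lambda>x. v x i)" for i
    unfolding v_def
  proof (intro continuous_intros u_cont s_cont continuous_on_compose2[OF u_cont[of UNIV]]
      continuous_on_compose2[OF s_cont[of UNIV]])
    show "\<forall>x\<in>?S. s x \<noteq> 0" "\<forall>x\<in>?S. s (- x) \<noteq> 0"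
      using s_pos by (force, metis less_irrefl mem_sphere_0 norm_minus_cancel)
  qed auto
  have v_odd: "v (- x) i = - v x i" for x i
    by (simp add: v_def)
  \<comment> \<open>Exponents start at 1: the zeroth moment vanishes by normalisation, so
    \<open>DIM('a) - 1\<close> odd functions suffice.\<close>
  have "\<exists>x\<in>?S. \<forall>j<DIM('a) - 1. (\<Sum>i<k. v x i * real i ^ Suc j) = 0"
    by (intro Borsuk_Ulam_odd continuous_intros v_cont) (simp add: v_odd sum_negf)
  then obtain x where x: "x \<in> ?S"
    and moments: "\<And>j. j < DIM('a) - 1 \<Longrightarrow> (\<Sum>i<k. v x i * real i ^ Suc j) = 0"
    by blast
  have mx: "- x \<in> ?S" using x by simp
  have "(\<Sum>i<k. v x i) = s x / s x - s (- x) / s (- x)"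
    unfolding v_def sum_subtractf by (simp add: sum_divide_distrib[symmetric] s_def[symmetric])
  then have sum0: "(\<Sum>i<k. v x i) = 0"
    using s_pos[OF x] s_pos[OF mx] by simp
  have all_moments: "(\<Sum>i<k. v x i * real i ^ j) = 0" if "j < DIM('a)" for j
    using that sum0 moments[of "j - 1"] by (cases j) auto
  have "{i \<in> {..<k}. v x i \<noteq> 0} \<subseteq> {i. i < k \<and> x \<in> U i} \<union> {i. i < k \<and> - x \<in> U i}"
    using u_pos[OF _ x] u_pos[OF _ mx] u_ge by (force simp: v_def less_le)
  then have "card {i \<in> {..<k}. v x i \<noteq> 0} \<le> card ({i. i < k \<and> x \<in> U i} \<union> {i. i < k \<and> - x \<in> U i})"
    by (intro card_mono) auto
  also have "\<dots> \<le> DIM('a)"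
    using few[OF x] few[OF mx] card_Un_le[of "{i. i < k \<and> x \<in> U i}" "{i. i < k \<and> - x \<in> U i}"] by linarith
  finally have v0: "v x i = 0" if "i < k" for i
    using that all_moments by (intro vanishing_moments_imp_zero[of "{..<k}" "v x" "DIM('a)"]) auto
  obtain i where i: "i < k" "x \<in> U i" using cover[OF x] by blast
  have "u i (- x) = 0"
    using u_pos[OF i(1) mx] anti[OF i] u_ge[of i "- x"] by auto
  then have "v x i > 0"
    using u_pos[OF i(1) x] i s_pos[OF x] by (simp add: v_def)
  then show False using v0[OF i(1)] by simp
qed

text \<open>Keeping in each set only the points already covered \<open>n - 1\<close> times by the earlier sets lowers all
  multiplicities by exactly \<open>n - 1\<close>.\<close>
lemma antipodal_nfold_cover_multiplicity:
  fixes U :: "nat \<Rightarrow> 'a::euclidean_space set"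
  assumes "1 \<le> n"
    and opn: "\<And>i. i < k \<Longrightarrow> openin (top_of_set (sphere 0 1)) (U i)"
    and anti: "\<And>i x. i < k \<Longrightarrow> x \<in> U i \<Longrightarrow> - x \<notin> U i"
    and cover: "\<And>x. x \<in> sphere 0 1 \<Longrightarrow> n \<le> card {i. i < k \<and> x \<in> U i}"
  shows "\<exists>x\<in>sphere 0 1. DIM('a) div 2 + n \<le> card {i. i < k \<and> x \<in> U i}"
proof -
  define A where "A x = {i. i < k \<and> x \<in> U i}" for x
  define B where "B i = {x \<in> U i. n - 1 \<le> card (A x \<inter> {..<i})}" for i
  have finA: "finite (A x)" for x by (simp add: A_def)
  have "openin (top_of_set (sphere 0 1)) (B i)" if "i < k" for i
  proof (subst openin_subopen, intro ballI)
    fix x assume x: "x \<in> B i"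
    \<comment> \<open>Points of \<open>?T\<close> lie in every set containing \<open>x\<close>, so
      the count of earlier sets cannot drop.\<close>
    let ?T = "U i \<inter> (\<Inter>j\<in>A x. U j)"
    have iA: "i \<in> A x" using x that by (auto simp: B_def A_def)
    then have "openin (top_of_set (sphere 0 1)) (\<Inter>j\<in>A x. U j)"
      using finA by (intro openin_INT2) (auto simp: A_def opn)
    then have "openin (top_of_set (sphere 0 1)) ?T"
      using opn[OF that] by blast
    moreover have "x \<in> ?T" using x by (auto simp: B_def A_def)
    moreover have "?T \<subseteq> B i"
    proof
      fix y assume y: "y \<in> ?T"
      have "card (A x \<inter> {..<i}) \<le> card (A y \<inter> {..<i})"
        using y finA by (intro card_mono) (auto simp: A_def)
      then show "y \<in> B i" using x y by (auto simp: B_def)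
    qed
    ultimately show "\<exists>T. openin (top_of_set (sphere 0 1)) T \<and> x \<in> T \<and> T \<subseteq> B i" by blast
  qed
  moreover have "- x \<notin> B i" if "i < k" "x \<in> B i" for i x
    using that anti by (auto simp: B_def)
  moreover have "\<exists>i<k. x \<in> B i" if "x \<in> sphere 0 1" for x
  proof -
    have cA: "n \<le> card (A x)" using cover[OF that] by (simp add: A_def)
    then have "A x \<noteq> {}" using \<open>1 \<le> n\<close> by auto
    \<comment> \<open>The last set containing \<open>x\<close> is preceded by at least
      \<open>n - 1\<close> others, so \<open>x\<close> survives in it.\<close>
    then have M: "Max (A x) \<in> A x" using finA by simp
    have "A x - {Max (A x)} \<subseteq> A x \<inter> {..<Max (A x)}"
      using finA by (auto simp: less_le)
    then have "card (A x - {Max (A x)}) \<le> card (A x \<inter> {..<Max (A x)})"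
      using finA by (intro card_mono) auto
    then show ?thesis
      using cA M finA by (intro exI[of _ "Max (A x)"]) (auto simp: B_def A_def[of x])
  qed
  ultimately obtain x where x: "x \<in> sphere 0 1" "DIM('a) div 2 + 1 \<le> card {i. i < k \<and> x \<in> B i}"
    using antipodal_cover_multiplicity[of k B] by blast
  define C where "C = {i. i < k \<and> x \<in> B i}"
  have finC: "finite C" by (simp add: C_def)
  have "0 < card C" using x(2) unfolding C_def by linarith
  then have "C \<noteq> {}" by auto
  \<comment> \<open>Before the first member of \<open>C\<close> come at least \<open>n - 1\<close>
    sets containing \<open>x\<close>, none of them in \<open>C\<close>.\<close>
  then have M: "Min C \<in> C" using finC by simp
  have "C \<inter> (A x \<inter> {..<Min C}) = {}"
    using finC by (auto dest: Min_le)
  then have "card C + card (A x \<inter> {..<Min C}) = card (C \<union> (A x \<inter> {..<Min C}))"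
    using finA finC by (simp add: card_Un_disjoint)
  also have "\<dots> \<le> card (A x)"
    using finA by (intro card_mono) (auto simp: C_def B_def A_def)
  finally have "card C + (n - 1) \<le> card (A x)"
    using M by (auto simp: C_def B_def)
  then show ?thesis
    using x \<open>1 \<le> n\<close> by (intro bexI[of _ x]) (auto simp: C_def A_def)
qed

section \<open>Lower bound for the number of sets\<close>

lemma antipodal_nm_cover_lower_bound:
  fixes U :: "nat \<Rightarrow> ('a::euclidean_space \<times> real) set"
  assumes "1 \<le> n" and U: "antipodal_nm_cover n m k U"
  shows "DIM('a) div 2 + n + m \<le> k"
proof -
  let ?S = "sphere (0::'a \<times> real) 1"
  \<comment> \<open>Traces on the equator, which is the unit sphere of \<open>'a\<close>.\<close>
  define V where "V i = {y \<in> sphere 0 1. (y, 0) \<in> U i}" for i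
  have opn: "openin (top_of_set ?S) (U i)" if "i < k" for i
    using U that by (simp add: antipodal_nm_cover_def)
  have anti: "- x \<notin> U i" if "i < k" "x \<in> U i" for i x
    using U that by (simp add: antipodal_nm_cover_def)
  have "openin (top_of_set (sphere 0 1)) (V i)" if "i < k" for i
  proof -
    have "openin (top_of_set (sphere 0 1)) (sphere 0 1 \<inter> (\<lambda>y. (y, 0)) -` U i)"
      by (rule continuous_openin_preimage[OF _ _ opn[OF that]]) (auto intro!: continuous_intros simp: norm_Pair)
    then show ?thesis by (simp add: V_def Int_def vimage_def)
  qed
  moreover have "- y \<notin> V i" if "i < k" "y \<in> V i" for i y
    using anti[OF that(1), of "(y, 0)"] that by (auto simp: V_def)
  moreover have "n \<le> card {i. i < k \<and> y \<in> V i}" if "y \<in> sphere 0 1" for y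
  proof -
    have "(y, 0) \<in> ?S" using that by (simp add: norm_Pair)
    then show ?thesis using U that by (auto simp: antipodal_nm_cover_def V_def)
  qed
  ultimately obtain y where y: "y \<in> sphere 0 1" "DIM('a) div 2 + n \<le> card {i. i < k \<and> y \<in> V i}"
    using antipodal_nfold_cover_multiplicity[OF \<open>1 \<le> n\<close>, of k V] by blast
  define A where "A = {i. i < k \<and> y \<in> V i}"
  have finA: "finite A" by (simp add: A_def)
  \<comment> \<open>A great-circle arc leaving the equator at \<open>y\<close> southwards;
    \<open>- c t\<close> is northern for \<open>0 < t < pi\<close>.\<close>
  define c where "c t = (cos t *\<^sub>R y, - sin t)" for t :: real
  have c_S: "c t \<in> ?S" for t
    using y(1) by (simp add: c_def norm_Pair)
  have "\<forall>\<^sub>F t in at_right 0. c t \<in> U i" if "i \<in> A" for i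
  proof -
    have "openin (top_of_set ?S) (U i)" using that by (simp add: A_def opn)
    then obtain T where T: "open T" "U i = ?S \<inter> T" by (auto simp: openin_open)
    have "(c \<longlongrightarrow> c 0) (at_right 0)"
      unfolding c_def by (intro tendsto_intros)
    moreover have "c 0 \<in> T"
      using that T by (auto simp: c_def A_def V_def)
    ultimately have "\<forall>\<^sub>F t in at_right 0. c t \<in> T"
      using T(1) by (auto dest: topological_tendstoD)
    then show ?thesis using c_S T(2) by simp
  qed
  then have "\<forall>\<^sub>F t in at_right 0. \<forall>i\<in>A. c t \<in> U i"
    using finA by (simp add: eventually_ball_finite)
  moreover have "\<forall>\<^sub>F t in at_right 0. t \<in> {0<..<pi}"
    by (rule eventually_at_right_real) simp
  ultimately have "\<forall>\<^sub>F t in at_right 0. (\<forall>i\<in>A. c t \<in> U i) \<and> t \<in> {0<..<pi}"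
    by (rule eventually_conj)
  from eventually_happens'[OF trivial_limit_at_right_real this]
  obtain t where t: "\<And>i. i \<in> A \<Longrightarrow> c t \<in> U i" "0 < t" "t < pi"
    by auto
  define D where "D = {i. i < k \<and> - c t \<in> U i}"
  have "- c t \<in> ?S" using c_S[of t] by simp
  moreover have "0 < snd (- c t)" using t sin_gt_zero by (simp add: c_def)
  ultimately have "m \<le> card D"
    using U unfolding antipodal_nm_cover_def D_def by blast
  \<comment> \<open>A set counted twice would contain both \<open>c t\<close> and
    \<open>- c t\<close>.\<close>
  moreover have "A \<inter> D = {}"
    using t(1) anti unfolding D_def by blast
  then have "card A + card D = card (A \<union> D)"
    using finA by (simp add: card_Un_disjoint D_def)
  moreover have "card (A \<union> D) \<le> card {..<k}"
    by (intro card_mono) (auto simp: A_def D_def)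
  ultimately show ?thesis
    using y(2) by (simp add: A_def)
qed

section \<open>Upper bound by Gale's hemispheres\<close>

lemma antipodal_nm_cover_exists:
  assumes "1 \<le> n" "n < m"
  shows "\<exists>U :: nat \<Rightarrow> ('a::euclidean_space \<times> real) set. antipodal_nm_cover n m (DIM('a) + n + m) U"
proof -
  let ?S = "sphere (0::'a \<times> real) 1"
  let ?d = "DIM('a)"
  obtain b :: "nat \<Rightarrow> 'a \<times> real" where "bij_betw b {0..<DIM('a \<times> real)} Basis"
    using ex_bij_betw_nat_finite[OF finite_Basis] by blast
  then have "bij_betw b {..<DIM('a \<times> real)} Basis" by (simp only: atLeast0LessThan)
  then interpret basis_enumeration b by unfold_locales
  define p :: "'a \<times> real \<Rightarrow> real poly" where "p x = (\<Sum>j\<le>?d. Polynomial.monom (x \<bullet> b j) j)" for x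
  \<comment> \<open>Below \<open>d + n + m\<close> there are \<open>d + 2 * n\<close> Gale
    hemispheres and \<open>m - n\<close> northern ones.\<close>
  define U where "U i = (if i < ?d + 2 * n then {x \<in> ?S. 0 < (-1) ^ i * poly (p x) (real i)}
      else {x \<in> ?S. 0 < snd x})" for i
  have coeff_p: "poly.coeff (p x) j = (if j \<le> ?d then x \<bullet> b j else 0)" for x j
    by (simp add: p_def coeff_sum)
  have deg_p: "degree (p x) \<le> ?d" for x
    by (rule degree_le) (simp add: coeff_p)
  have p_nz: "p x \<noteq> 0" if "x \<in> ?S" for x
  proof
    assume "p x = 0"
    then have "x \<bullet> b j = 0" if "j < DIM('a \<times> real)" for j
      using coeff_p[of x j] that by auto
    then have "x = 0" by (intro eq_coordI) simp
    then show False using that by simp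
  qed
  have p_minus: "p (- x) = - p x" for x
    by (rule poly_eqI) (simp add: coeff_p)
  have poly_p: "poly (p x) a = (\<Sum>j\<le>?d. (x \<bullet> b j) * a ^ j)" for x a
    by (simp add: p_def poly_sum poly_monom)
  have indices_eq: "{i. i < ?d + 2 * n \<and> x \<in> U i} = {i. i < ?d + 2 * n \<and> 0 < (-1) ^ i * poly (p x) (real i)}"
    if "x \<in> ?S" for x
    using that by (auto simp: U_def)
  have ge_n: "n \<le> card {i. i < ?d + 2 * n \<and> x \<in> U i}" if "x \<in> ?S" for x
    unfolding indices_eq[OF that]
    using p_nz[OF that] deg_p \<open>1 \<le> n\<close> by (rule card_alternating_positive_ge)
  have "antipodal_nm_cover n m (?d + n + m) U"
    unfolding antipodal_nm_cover_def
  proof (intro conjI ballI allI impI)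
    fix i
    show "U i \<subseteq> ?S" by (auto simp: U_def)
    have "open {x. 0 < (-1) ^ i * poly (p x) (real i)}"
      unfolding poly_p by (intro open_Collect_less continuous_intros)
    moreover have "open {x :: 'a \<times> real. 0 < snd x}"
      by (intro open_Collect_less continuous_intros)
    ultimately show "openin (top_of_set ?S) (U i)"
      by (auto simp: U_def Collect_conj_eq openin_open)
    show "- x \<notin> U i" if "x \<in> U i" for x
      using that by (auto simp: U_def p_minus split: if_splits)
  next
    fix x assume x: "x \<in> ?S"
    have sub: "{i. i < ?d + 2 * n \<and> x \<in> U i} \<subseteq> {i. i < ?d + n + m \<and> x \<in> U i}"
      using \<open>n < m\<close> by auto
    have "card {i. i < ?d + 2 * n \<and> x \<in> U i} \<le> card {i. i < ?d + n + m \<and> x \<in> U i}"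
      using sub by (intro card_mono) auto
    then show "n \<le> card {i. i < ?d + n + m \<and> x \<in> U i}"
      using ge_n[OF x] by simp
    assume "0 < snd x"
    then have "{?d + 2 * n..<?d + n + m} \<union> {i. i < ?d + 2 * n \<and> x \<in> U i}
        \<subseteq> {i. i < ?d + n + m \<and> x \<in> U i}"
      using sub x by (auto simp: U_def)
    then have "card ({?d + 2 * n..<?d + n + m} \<union> {i. i < ?d + 2 * n \<and> x \<in> U i})
        \<le> card {i. i < ?d + n + m \<and> x \<in> U i}"
      by (intro card_mono) auto
    moreover have "card ({?d + 2 * n..<?d + n + m} \<union> {i. i < ?d + 2 * n \<and> x \<in> U i})
        = (m - n) + card {i. i < ?d + 2 * n \<and> x \<in> U i}"
      by (subst card_Un_disjoint) auto
    ultimately show "m \<le> card {i. i < ?d + n + m \<and> x \<in> U i}"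
      using ge_n[OF x] \<open>n < m\<close> by linarith
  qed
  then show ?thesis by blast
qed

theorem theorem5:
  fixes n m :: nat
  assumes "1 \<le> n" and "n < m"
  shows "\<lceil>(real DIM('a::euclidean_space) - 1) / 2\<rceil> + int n + int m
           \<le> int (min_antipodal_cover TYPE('a) n m)
         \<and> min_antipodal_cover TYPE('a) n m \<le> DIM('a) + n + m"
proof
  \<comment> \<open>Existence guarantees that \<open>LEAST\<close> is attained, which both bounds
    use.\<close>
  have ex: "\<exists>U :: nat \<Rightarrow> ('a \<times> real) set. antipodal_nm_cover n m (DIM('a) + n + m) U"
    using assms by (rule antipodal_nm_cover_exists)
  show "min_antipodal_cover TYPE('a) n m \<le> DIM('a) + n + m"
    unfolding min_antipodal_cover_def using ex by (rule Least_le)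
  have "\<exists>U :: nat \<Rightarrow> ('a \<times> real) set. antipodal_nm_cover n m (min_antipodal_cover TYPE('a) n m) U"
    unfolding min_antipodal_cover_def using ex by (rule LeastI)
  then have "DIM('a) div 2 + n + m \<le> min_antipodal_cover TYPE('a) n m"
    using antipodal_nm_cover_lower_bound[OF \<open>1 \<le> n\<close>] by blast
  \<comment> \<open>This is the rounding identity: \<open>(d - 1) / 2\<close> rounded up is
    \<open>d / 2\<close> rounded down.\<close>
  moreover have "real DIM('a) \<le> 2 * real (DIM('a) div 2) + 1"
    by linarith
  then have "\<lceil>(real DIM('a) - 1) / 2\<rceil> \<le> int (DIM('a) div 2)"
    by (simp add: ceiling_le_iff)
  ultimately show "\<lceil>(real DIM('a) - 1) / 2\<rceil> + int n + int m \<le> int (min_antipodal_cover TYPE('a) n m)"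
    by linarith
qed

end
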